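(* Let $2\le k\le n-1$ and let $\gamma_k\in(0,1)$ be as specified in the context. Then there exists $\gamma^{(k)}>0$ such that for all $\lambda\in\Sigma_{(\gamma_k)}$ and all $\eta\in\mathbb{R}^n$, $$\widetilde{d^2f_k(\lambda,\eta)}\le-\gamma^{(k)}|\eta|^2 .$$ That is, the negative definiteness of the quadratic form $\eta\mapsto\widetilde{d^2f_k(\lambda,\eta)}$ is uniform with respect to $\lambda\in\Sigma_{(\gamma_k)}$.
   Context: $\Gamma_n=\{\lambda\in\mathbb{R}^n:\lambda_j>0,\ j=1,\dots,n\}$, $\sigma_k(\lambda)=\sum_{1\le i_1<\cdots<i_k\le n}\lambda_{i_1}\cdots\lambda_{i_k}$, and $f_k(\lambda)=\log\sigma_k(\lambda)$ on $\Gamma_n$. For $\xi\in\mathbb{R}^n$, $d^2f_k(\lambda,\xi)=\sum_{i,j=1}^n\frac{\partial^2f_k(\lambda)}{\partial\lambda_i\partial\lambda_j}\xi_i\xi_j$. For $\eta\in\mathbb{R}^n$, $\widetilde{d^2f_k(\lambda,\eta)}:=d^2f_k(\lambda,\lambda\eta)$, where $\lambda\eta=(\lambda_1\eta_1,\dots,\lambda_n\eta_n)$. $|\eta|$ is the Euclidean norm. $\Sigma_{(\gamma_k)}$ is the set of $\lambda\in\Gamma_n$ with $\min_j\lambda_j\ge\gamma_k\max_j\lambda_j$, where: (i) if $k\in\{2,3,4,n-2,n-1\}$, $\gamma_k$ is some fixed number in $(0,1)$; (ii) if $[\frac n2]+1\le k\le n-3$, $\gamma_k=\frac{n-k}{k}$;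 (iii) if $5\le k\le[\frac n2]$, $\gamma_k=\frac{k-2}{n-(k-2)}$. *)

theory Defs
  imports "HOL-Analysis.Analysis"
begin

text \<open>
  Points of $\mathbb{R}^n$ are vectors of type \<open>real ^ 'n\<close>, so that $n$ is \<open>CARD('n)\<close>.
\<close>

definition positive_cone :: "(real ^ 'n) set"
  where "positive_cone = {x. \<forall>j. 0 < x $ j}"

text \<open>Increasing tuples $i_1 < \cdots < i_k$ of indices correspond to \<open>k\<close>-element index sets.\<close>

definition elem_sym :: "nat \<Rightarrow> real ^ 'n \<Rightarrow> real"
  where "elem_sym k x = (\<Sum>I | card I = k. \<Prod>i\<in>I. x $ i)"

text \<open>
  The function is only meaningful where \<open>elem_sym k\<close> is positive, in particular on
  \<open>positive_cone\<close>. That cone is open, so the values of the total function outside it do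
  not affect derivatives at its points.
\<close>

definition log_elem_sym :: "nat \<Rightarrow> real ^ 'n \<Rightarrow> real"
  where "log_elem_sym k x = ln (elem_sym k x)"

definition partial_deriv :: "'n \<Rightarrow> (real ^ 'n \<Rightarrow> real) \<Rightarrow> real ^ 'n \<Rightarrow> real"
  where "partial_deriv i f x = deriv (\<lambda>t. f (x + t *\<^sub>R axis i 1)) 0"

definition second_differential :: "(real ^ 'n \<Rightarrow> real) \<Rightarrow> real ^ 'n \<Rightarrow> real ^ 'n \<Rightarrow> real"
  where "second_differential f x v =
    (\<Sum>i\<in>UNIV. \<Sum>j\<in>UNIV. partial_deriv i (partial_deriv j f) x * (v $ i) * (v $ j))"

definition scaled_second_differential ::
    "(real ^ 'n \<Rightarrow> real) \<Rightarrow> real ^ 'n \<Rightarrow> real ^ 'n \<Rightarrow> real"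
  where "scaled_second_differential f x w = second_differential f x (\<chi> i. x $ i * w $ i)"

text \<open>
  In the first case any number in $(0,1)$ is allowed. The first two cases overlap for
  $n = 7$, $k = 4$ (the only overlap); there the first case takes effect, as it includes the
  value prescribed by the second.
\<close>

definition admissible_ratio :: "nat \<Rightarrow> nat \<Rightarrow> real \<Rightarrow> bool"
  where "admissible_ratio n k \<gamma> \<longleftrightarrow>
    (k \<in> {2, 3, 4, n - 2, n - 1} \<and> 0 < \<gamma> \<and> \<gamma> < 1) \<or>
    (n div 2 + 1 \<le> k \<and> k + 3 \<le> n \<and> \<gamma> = (real n - real k) / real k) \<or>
    (5 \<le> k \<and> k \<le> n div 2 \<and> \<gamma> = (real k - 2) / (real n - (real k - 2)))"

definition pinched_cone :: "real \<Rightarrow> (real ^ 'n) set"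
  where "pinched_cone \<gamma> =
    {x \<in> positive_cone. \<gamma> * Max (range (\<lambda>j. x $ j)) \<le> Min (range (\<lambda>j. x $ j))}"

end

theory Submission
  imports Defs
begin

text \<open>
  Write \<open>e\<^sub>k\<close> for the elementary symmetric polynomials and \<open>q\<^sub>k = e\<^sub>k\<^sub>+\<^sub>1 / e\<^sub>k\<close>.
  Since \<open>ln e\<^sub>k = ln e\<^sub>2 + ln q\<^sub>2 + \<dots> + ln q\<^sub>k\<^sub>-\<^sub>1\<close>, and every \<open>q\<^sub>j\<close> is concave on the
  positive cone (Marcus and Lopes), the function \<open>ln e\<^sub>k - ln e\<^sub>2\<close> is concave there
  (\<open>concave_on_ln_esym_ratio\<close>). So the Hessian of \<open>ln e\<^sub>k\<close> is bounded above by that of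
  \<open>ln e\<^sub>2\<close>, which is explicit because \<open>2 e\<^sub>2(x) = (\<Sum>x\<^sub>i)\<^sup>2 - \<Sum>x\<^sub>i\<^sup>2\<close>.

  Concavity of \<open>q\<^sub>k\<close> comes from an induction over index sets. Two recursions of \<open>e\<^sub>k\<close>
  combine to \<open>(k + 1) q\<^sub>k(S) = \<Sum>\<^sub>i x\<^sub>i q\<^sub>k\<^sub>-\<^sub>1(S - i) / (x\<^sub>i + q\<^sub>k\<^sub>-\<^sub>1(S - i))\<close>
  (\<open>esym_quotient_recursion\<close>), and \<open>a b / (a + b)\<close> is increasing and superadditive. Hence
  \<open>q\<^sub>k\<close> is superadditive; being homogeneous of degree one, it is concave.

  For \<open>e\<^sub>2\<close>, put \<open>s = \<Sum>x\<^sub>i\<close> and split a direction as \<open>v = m x + z\<close> with \<open>\<Sum>z\<^sub>i = 0\<close>.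
  Completing a square bounds the second derivative of \<open>ln e\<^sub>2\<close> along \<open>v\<close> by
  \<open>- m\<^sup>2 - 2 \<bar>z\<bar>\<^sup>2 / s\<^sup>2\<close> (\<open>second_differential_log_elem_sym_le\<close>): the logarithm
  controls the radial part, and \<open>z\<close> is controlled because \<open>e\<^sub>2\<close> is strictly concave in directions
  with coordinate sum zero.
  For \<open>v\<^sub>i = x\<^sub>i w\<^sub>i\<close> we have \<open>z\<^sub>i = x\<^sub>i (w\<^sub>i - m)\<close>, and pinching gives
  \<open>x\<^sub>i / s \<ge> \<gamma> / n\<close>, so the bound becomes \<open>- m\<^sup>2 - 2 (\<gamma> / n)\<^sup>2 \<Sum>(w\<^sub>i - m)\<^sup>2\<close>, which is
  uniformly negative definite in \<open>w\<close>.
\<close>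

section \<open>Elementary symmetric polynomials of a subset of the variables\<close>

text \<open>The set of variables is a parameter because the induction below deletes variables.\<close>

definition esym :: "nat \<Rightarrow> 'n set \<Rightarrow> real ^ 'n \<Rightarrow> real"
  where "esym k S x = (\<Sum>I | I \<subseteq> S \<and> card I = k. \<Prod>i\<in>I. x $ i)"

lemma elem_sym_eq_esym: "elem_sym k x = esym k UNIV x"
  by (simp add: elem_sym_def esym_def)

lemma esym_0 [simp]: "esym 0 S (x :: real ^ 'n) = 1"
proof -
  have "{I. I \<subseteq> S \<and> card I = 0} = {{}}" by (auto simp: card_eq_0_iff)
  then show ?thesis by (simp add: esym_def)
qed

lemma esym_Suc_empty [simp]: "esym (Suc k) {} x = 0"
  by (simp add: esym_def)

lemma esym_Suc_insert:
  assumes "a \<notin> S"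
  shows "esym (Suc k) (insert a S) x = esym (Suc k) S x + x $ a * esym k S (x :: real ^ 'n)"
proof -
  let ?A = "{I. I \<subseteq> S \<and> card I = Suc k}" and ?B = "{I. I \<subseteq> S \<and> card I = k}"
  have split: "{I. I \<subseteq> insert a S \<and> card I = Suc k} = ?A \<union> insert a ` ?B" (is "?L = ?R")
  proof
    show "?R \<subseteq> ?L" using assms by (auto simp: card_insert_if subset_iff)
    show "?L \<subseteq> ?R"
    proof
      fix I assume I: "I \<in> ?L"
      show "I \<in> ?R"
      proof (cases "a \<in> I")
        case True
        then have "I = insert a (I - {a})" "I - {a} \<in> ?B" using I by auto
        then show ?thesis by blast
      next
        case False
        then show ?thesis using I by auto
      qed
    qed
  qed
  have inj: "inj_on (insert a) ?B" using assms by (auto simp: inj_on_def)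
  have "esym (Suc k) (insert a S) x
      = (\<Sum>I\<in>?A. \<Prod>i\<in>I. x $ i) + (\<Sum>I\<in>insert a ` ?B. \<Prod>i\<in>I. x $ i)"
    unfolding esym_def split by (rule sum.union_disjoint) (use assms in auto)
  also have "(\<Sum>I\<in>insert a ` ?B. \<Prod>i\<in>I. x $ i) = (\<Sum>I\<in>?B. \<Prod>i\<in>insert a I. x $ i)"
    by (simp add: sum.reindex[OF inj])
  also have "\<dots> = (\<Sum>I\<in>?B. x $ a * (\<Prod>i\<in>I. x $ i))"
    using assms by (intro sum.cong refl) (auto intro!: prod.insert)
  finally show ?thesis by (simp add: esym_def sum_distrib_left)
qed

lemma esym_Suc_remove:
  assumes "i \<in> S"
  shows "esym (Suc k) S x = esym (Suc k) (S - {i}) x + x $ i * esym k (S - {i}) (x :: real ^ 'n)"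
  using esym_Suc_insert[of i "S - {i}" k x] assms by (simp add: insert_absorb)

text \<open>
  The induction step shared by Euler's identity (\<open>c = x\<close>) and the formula for the derivative
  (\<open>c\<close> a tangent vector), both of which are sums over the partial derivatives
  \<open>esym k (S - {j})\<close>.
\<close>
lemma sum_esym_remove_insert:
  fixes x :: "real ^ 'n"
  assumes "a \<notin> S"
  shows "(\<Sum>j\<in>insert a S. c j * esym (Suc k) (insert a S - {j}) x) =
    c a * esym (Suc k) S x + (\<Sum>j\<in>S. c j * esym (Suc k) (S - {j}) x)
      + x $ a * (\<Sum>j\<in>S. c j * esym k (S - {j}) x)"
proof -
  have "c j * esym (Suc k) (insert a S - {j}) x
      = c j * esym (Suc k) (S - {j}) x + x $ a * (c j * esym k (S - {j}) x)" if "j \<in> S" for j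
  proof -
    have "insert a S - {j} = insert a (S - {j})" using that assms by auto
    then show ?thesis using assms by (simp add: esym_Suc_insert algebra_simps)
  qed
  then show ?thesis using assms
    by (simp add: sum.distrib sum_distrib_left insert_Diff_if)
qed

text \<open>Euler's identity: \<open>esym (Suc k) S\<close> is homogeneous of degree \<open>k + 1\<close>, with partial
  derivatives \<open>esym k (S - {i})\<close>.\<close>
lemma esym_Euler:
  fixes x :: "real ^ 'n"
  shows "real (Suc k) * esym (Suc k) S x = (\<Sum>i\<in>S. x $ i * esym k (S - {i}) x)"
proof (induction S arbitrary: k rule: finite_induct[OF finite])
  case (2 a S)
  show ?case
  proof (cases k)
    case 0
    then show ?thesis using 2(3)[of 0] 2(2) by (simp add: esym_Suc_insert)
  next
    case (Suc m)
    show ?thesis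
      unfolding Suc sum_esym_remove_insert[OF 2(2)] 2(3)[symmetric] esym_Suc_insert[OF 2(2)]
      by (simp add: algebra_simps)
  qed
qed simp

text \<open>The polynomial is affine in each \<open>x\<^sub>j\<close> with slope \<open>esym k (S - {j})\<close>, by
  \<open>esym_Suc_remove\<close>.\<close>
lemma has_derivative_esym:
  fixes x :: "real ^ 'n"
  shows "(esym (Suc k) S has_derivative (\<lambda>h. \<Sum>j\<in>S. h $ j * esym k (S - {j}) x)) (at x)"
proof (induction S arbitrary: k rule: finite_induct[OF finite])
  case 1
  have "esym (Suc k) {} = (\<lambda>x :: real ^ 'n. 0)" by auto
  then show ?case by simp
next
  case (2 a S)
  have eq: "esym (Suc k) (insert a S) = (\<lambda>x. esym (Suc k) S x + x $ a * esym k S x)"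
    using 2(2) by (auto simp: esym_Suc_insert)
  have nth: "((\<lambda>y. y $ a) has_derivative (\<lambda>h. h $ a)) (at x)"
    by (rule bounded_linear.has_derivative[OF bounded_linear_vec_nth has_derivative_ident])
  show ?case
  proof (cases k)
    case 0
    have eq0: "esym 0 S = (\<lambda>x :: real ^ 'n. 1)" by auto
    show ?thesis unfolding 0 eq[unfolded 0] eq0
      by (rule has_derivative_eq_rhs[OF has_derivative_add[OF 2(3)
            has_derivative_mult[OF nth has_derivative_const]]])
        (use 2(1,2) in auto)
  next
    case (Suc m)
    show ?thesis unfolding eq unfolding Suc sum_esym_remove_insert[OF 2(2)]
      by (rule has_derivative_eq_rhs[OF has_derivative_add[OF 2(3)
            has_derivative_mult[OF nth 2(3)]]])
        (auto simp: algebra_simps)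
  qed
qed

lemma esym_pos:
  fixes x :: "real ^ 'n"
  assumes "x \<in> positive_cone" and "k \<le> card S"
  shows "0 < esym k S x"
proof -
  obtain T where "T \<subseteq> S" "card T = k" using assms(2) by (metis obtain_subset_with_card_n)
  then show ?thesis
    unfolding esym_def using assms(1)
    by (intro sum_pos prod_pos) (auto simp: positive_cone_def)
qed

lemma esym_scale: "esym k S (c *\<^sub>R x) = c ^ k * esym k S (x :: real ^ 'n)"
  unfolding esym_def sum_distrib_left
  by (intro sum.cong refl) (auto simp: prod.distrib)

lemma esym_1: "esym (Suc 0) S x = (\<Sum>i\<in>S. x $ i)"
  using esym_Euler[of 0 S x] by simp

lemma esym_2:
  fixes x :: "real ^ 'n"
  shows "2 * esym 2 S x = (\<Sum>i\<in>S. x $ i)\<^sup>2 - (\<Sum>i\<in>S. (x $ i)\<^sup>2)"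
proof (induction S rule: finite_induct[OF finite])
  case (2 a S)
  have "esym 2 (insert a S) x = esym 2 S x + x $ a * (\<Sum>i\<in>S. x $ i)"
    using esym_Suc_insert[OF 2(2), of 1 x] by (simp add: esym_1 numeral_2_eq_2)
  then show ?case using 2 by (simp add: power2_eq_square algebra_simps)
qed (simp add: numeral_2_eq_2)

section \<open>Concavity of quotients of consecutive elementary symmetric polynomials\<close>

text \<open>The parallel sum (of resistances), that is, half the harmonic mean.\<close>
definition parallel :: "real \<Rightarrow> real \<Rightarrow> real"
  where "parallel a b = a * b / (a + b)"

lemma parallel_mono:
  assumes "0 < a" "0 < b" "b \<le> c"
  shows "parallel a b \<le> parallel a c"
proof -
  have "a * b * (a + c) \<le> a * c * (a + b)"
    using assms by (simp add: algebra_simps mult_left_mono)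
  then show ?thesis using assms unfolding parallel_def by (simp add: divide_simps)
qed

text \<open>The difference of the two sides is an explicit square over a positive denominator.\<close>
lemma parallel_superadditive:
  assumes "0 < a" "0 < b" "0 < c" "0 < d"
  shows "parallel a b + parallel c d \<le> parallel (a + c) (b + d)"
proof -
  have "parallel (a + c) (b + d) - (parallel a b + parallel c d)
      = (a * d - b * c)\<^sup>2 / ((a + b) * (c + d) * (a + b + c + d))"
  proof -
    have "a + b \<noteq> 0" "c + d \<noteq> 0" "a + c + (b + d) \<noteq> 0" "a+b+c+d \<noteq> 0" using assms by auto
    then show ?thesis unfolding parallel_def power2_eq_square
      by (simp add: divide_simps) algebra
  qed
  moreover have "0 \<le> \<dots>" using assms by simp
  ultimately show ?thesis by linarith
qed

definition esym_quotient :: "nat \<Rightarrow> 'n set \<Rightarrow> real ^ 'n \<Rightarrow> real"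
  where "esym_quotient k S x = esym (Suc k) S x / esym k S x"

lemma positive_cone_add: "x \<in> positive_cone \<Longrightarrow> y \<in> positive_cone \<Longrightarrow> x + y \<in> positive_cone"
  by (auto simp: positive_cone_def add_pos_pos)

lemma positive_cone_scale: "x \<in> positive_cone \<Longrightarrow> 0 < c \<Longrightarrow> c *\<^sub>R x \<in> positive_cone"
  by (auto simp: positive_cone_def)

lemma esym_quotient_pos:
  "x \<in> positive_cone \<Longrightarrow> Suc k \<le> card S \<Longrightarrow> 0 < esym_quotient k S (x :: real ^ 'n)"
  by (simp add: esym_quotient_def esym_pos)

text \<open>
  Euler's identity for the numerator gives summands \<open>x\<^sub>i e\<^sub>k\<^sub>+\<^sub>1(S - i) / e\<^sub>k\<^sub>+\<^sub>1(S)\<close>.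
  Splitting the denominator by \<open>esym_Suc_remove\<close> and dividing by \<open>e\<^sub>k(S - i)\<close> turns each
  summand into a parallel sum.
\<close>
lemma esym_quotient_recursion:
  fixes x :: "real ^ 'n"
  assumes "x \<in> positive_cone" and "Suc (Suc k) \<le> card S"
  shows "real (Suc (Suc k)) * esym_quotient (Suc k) S x
    = (\<Sum>i\<in>S. parallel (x $ i) (esym_quotient k (S - {i}) x))"
proof -
  have "x $ i * esym (Suc k) (S - {i}) x / esym (Suc k) S x
      = parallel (x $ i) (esym_quotient k (S - {i}) x)" if "i \<in> S" for i
  proof -
    have "card (S - {i}) = card S - 1" using that by simp
    then have "esym k (S - {i}) x > 0" "esym (Suc k) (S - {i}) x > 0" "x $ i > 0"
      using assms by (auto intro!: esym_pos simp: positive_cone_def)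
    then show ?thesis unfolding esym_Suc_remove[OF that, of k] esym_quotient_def parallel_def
      by (simp add: divide_simps)
  qed
  then have "(\<Sum>i\<in>S. x $ i * esym (Suc k) (S - {i}) x / esym (Suc k) S x)
    = (\<Sum>i\<in>S. parallel (x $ i) (esym_quotient k (S - {i}) x))"
    by (rule sum.cong[OF refl])
  moreover have "real (Suc (Suc k)) * esym_quotient (Suc k) S x
    = (\<Sum>i\<in>S. x $ i * esym (Suc k) (S - {i}) x / esym (Suc k) S x)"
    by (simp only: sum_divide_distrib[symmetric] esym_Euler[symmetric] esym_quotient_def
        times_divide_eq_right)
  ultimately show ?thesis by simp
qed

text \<open>By the recursion, superadditivity and monotonicity of the parallel sum carry superadditivity
  from the quotients with one variable deleted to the quotient itself.\<close>
lemma esym_quotient_superadditive: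
  fixes x y :: "real ^ 'n"
  assumes "x \<in> positive_cone" and "y \<in> positive_cone" and "Suc k \<le> card S"
  shows "esym_quotient k S x + esym_quotient k S y \<le> esym_quotient k S (x + y)"
  using assms(3)
proof (induction k arbitrary: S)
  case 0
  then show ?case by (simp add: esym_quotient_def esym_1 sum.distrib)
next
  case (Suc k)
  let ?q = "\<lambda>i z. esym_quotient k (S - {i}) z"
  have xy: "x + y \<in> positive_cone" by (simp add: assms positive_cone_add)
  have "parallel (x $ i) (?q i x) + parallel (y $ i) (?q i y)
      \<le> parallel ((x + y) $ i) (?q i (x + y))" if "i \<in> S" for i
  proof -
    have card: "Suc k \<le> card (S - {i})" using Suc.prems that by simp
    have pos: "0 < x $ i" "0 < y $ i" "0 < ?q i x" "0 < ?q i y"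
      using assms card by (auto simp: positive_cone_def intro!: esym_quotient_pos)
    have "parallel (x $ i) (?q i x) + parallel (y $ i) (?q i y)
        \<le> parallel (x $ i + y $ i) (?q i x + ?q i y)"
      by (rule parallel_superadditive) (fact pos)+
    also have "\<dots> \<le> parallel (x $ i + y $ i) (?q i (x + y))"
      using pos by (intro parallel_mono Suc.IH card) auto
    finally show ?thesis by simp
  qed
  then have "(\<Sum>i\<in>S. parallel (x $ i) (?q i x) + parallel (y $ i) (?q i y))
      \<le> (\<Sum>i\<in>S. parallel ((x + y) $ i) (?q i (x + y)))"
    by (rule sum_mono)
  then have "real (Suc (Suc k)) * (esym_quotient (Suc k) S x + esym_quotient (Suc k) S y)
      \<le> real (Suc (Suc k)) * esym_quotient (Suc k) S (x + y)"
    unfolding distrib_left sum.distrib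
      esym_quotient_recursion[OF assms(1) Suc.prems] esym_quotient_recursion[OF assms(2) Suc.prems]
      esym_quotient_recursion[OF xy Suc.prems] .
  then show ?case by simp
qed

lemma esym_quotient_scale:
  "c \<noteq> 0 \<Longrightarrow> esym_quotient k S (c *\<^sub>R x) = c * esym_quotient k S x"
  by (simp add: esym_quotient_def esym_scale)

lemma convex_positive_cone: "convex (positive_cone :: (real ^ 'n) set)"
  unfolding convex_alt
proof clarify
  fix x y :: "real ^ 'n" and u :: real
  assume xy: "x \<in> positive_cone" "y \<in> positive_cone" and u: "0 \<le> u" "u \<le> 1"
  show "(1 - u) *\<^sub>R x + u *\<^sub>R y \<in> positive_cone"
  proof (cases "u = 0 \<or> u = 1")
    case False
    then have "0 < u" "0 < 1 - u" using u by auto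
    then show ?thesis using xy by (intro positive_cone_add positive_cone_scale)
  qed (use xy in auto)
qed

text \<open>Superadditivity and homogeneity of degree one make the quotient concave, and the logarithm is
  increasing and concave.\<close>
lemma concave_on_ln_esym_quotient:
  assumes "Suc k \<le> card S"
  shows "concave_on positive_cone (\<lambda>x :: real ^ 'n. ln (esym_quotient k S x))"
  unfolding concave_on_def
proof (rule convex_onI)
  fix u :: real and x y :: "real ^ 'n"
  assume u: "0 < u" "u < 1" and xy: "x \<in> positive_cone" "y \<in> positive_cone"
  let ?q = "esym_quotient k S"
  have pos: "0 < ?q x" "0 < ?q y" using xy assms by (auto intro: esym_quotient_pos)
  have "(1 - u) * ln (?q x) + u * ln (?q y) \<le> ln ((1 - u) * ?q x + u * ?q y)"
    using concave_onD[OF ln_concave, of u "?q x" "?q y"] u pos by simp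
  also have "(1 - u) * ?q x + u * ?q y = ?q ((1 - u) *\<^sub>R x) + ?q (u *\<^sub>R y)"
    using u by (simp add: esym_quotient_scale)
  also have "ln \<dots> \<le> ln (?q ((1 - u) *\<^sub>R x + u *\<^sub>R y))"
    using xy u pos assms
    by (intro ln_mono esym_quotient_superadditive)
      (auto intro!: positive_cone_scale add_pos_pos esym_quotient_pos)
  finally show "- ln (?q ((1 - u) *\<^sub>R x + u *\<^sub>R y)) \<le> (1 - u) * - ln (?q x) + u * - ln (?q y)"
    by simp
qed (fact convex_positive_cone)

text \<open>The difference telescopes into the logarithms of the quotients \<open>e\<^sub>j\<^sub>+\<^sub>1 / e\<^sub>j\<close> with
  \<open>m \<le> j < k\<close>.\<close>
lemma concave_on_ln_esym_ratio:
  assumes "m \<le> k" and "k \<le> CARD('n)"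
  shows "concave_on positive_cone
    (\<lambda>x :: real ^ 'n. ln (esym k UNIV x) - ln (esym m UNIV x))"
  using assms
proof (induction k rule: dec_induct)
  case base
  then show ?case by (simp add: concave_on_def convex_on_def convex_positive_cone)
next
  case (step k)
  have "concave_on positive_cone (\<lambda>x :: real ^ 'n.
      (ln (esym k UNIV x) - ln (esym m UNIV x)) + ln (esym_quotient k UNIV x))"
    using step by (intro concave_on_add concave_on_ln_esym_quotient) auto
  moreover have "(ln (esym k UNIV x) - ln (esym m UNIV x)) + ln (esym_quotient k UNIV x)
      = ln (esym (Suc k) UNIV x) - ln (esym m UNIV x)" if "x \<in> positive_cone" for x :: "real ^ 'n"
  proof -
    have "0 < esym k UNIV x" "0 < esym (Suc k) UNIV x"
      using step.prems that by (auto intro!: esym_pos)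
    then show ?thesis by (simp add: esym_quotient_def ln_div)
  qed
  ultimately show ?case
    unfolding concave_on_iff by (auto simp: convexD[OF convex_positive_cone])
qed

section \<open>Second differentials as second derivatives along lines\<close>

lemma has_real_derivative_along_line:
  fixes f :: "real ^ 'n \<Rightarrow> real"
  assumes "(f has_derivative f') (at (x + t *\<^sub>R v))"
  shows "((\<lambda>t. f (x + t *\<^sub>R v)) has_real_derivative f' v) (at t)"
proof -
  have "((\<lambda>t. x + t *\<^sub>R v) has_derivative (\<lambda>s. s *\<^sub>R v)) (at t)"
    by (auto intro!: derivative_eq_intros)
  from has_derivative_compose[OF this assms]
  have "((\<lambda>t. f (x + t *\<^sub>R v)) has_derivative (\<lambda>s. f' (s *\<^sub>R v))) (at t)" .
  moreover have "(\<lambda>s. f' (s *\<^sub>R v)) = (*) (f' v)"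
    using linear_cmul[OF has_derivative_linear[OF assms]] by (auto simp: mult.commute)
  ultimately show ?thesis by (simp add: has_field_derivative_def)
qed

lemma partial_deriv_eqI:
  assumes "(f has_derivative f') (at x)"
  shows "partial_deriv i f x = f' (axis i 1)"
  unfolding partial_deriv_def
  by (rule DERIV_imp_deriv[OF has_real_derivative_along_line]) (use assms in simp)

lemma open_line_preimage:
  fixes x v :: "real ^ 'n"
  assumes "open U"
  shows "open {t. x + t *\<^sub>R v \<in> U}"
proof -
  have "open ((\<lambda>t. x + t *\<^sub>R v) -` U)"
    by (rule open_vimage[OF assms]) (intro continuous_intros)
  then show ?thesis by (simp add: vimage_def)
qed

lemma partial_deriv_cong_open:
  fixes x :: "real ^ 'n"
  assumes "open U" "x \<in> U" "\<And>y. y \<in> U \<Longrightarrow> f y = g y"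
  shows "partial_deriv i f x = partial_deriv i g x"
  unfolding partial_deriv_def
proof (rule deriv_cong_ev)
  have "eventually (\<lambda>t. t \<in> {t. x + t *\<^sub>R axis i 1 \<in> U}) (nhds (0::real))"
    using assms by (intro eventually_nhds_in_open open_line_preimage) auto
  then show "\<forall>\<^sub>F t in nhds 0. f (x + t *\<^sub>R axis i 1) = g (x + t *\<^sub>R axis i 1)"
    by (rule eventually_mono) (use assms(3) in auto)
qed simp

text \<open>
  The sum in the conclusion is the first derivative of \<open>t \<mapsto> f (x + t v)\<close>, so the second
  differential is the second derivative of this function at \<open>0\<close>. This makes one-variable
  concavity applicable to the iterated partial derivatives.
\<close>
lemma second_differential_along_line:
  fixes f :: "real ^ 'n \<Rightarrow> real"
  assumes "open U" "x \<in> U"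
    and f: "\<And>y. y \<in> U \<Longrightarrow> (f has_derivative (\<lambda>h. \<Sum>j\<in>UNIV. h $ j * G j y)) (at y)"
    and G: "\<And>j. G j differentiable (at x)"
  shows "((\<lambda>t. \<Sum>j\<in>UNIV. v $ j * G j (x + t *\<^sub>R v)) has_real_derivative
    second_differential f x v) (at 0)"
proof -
  obtain G' where G': "\<And>j. (G j has_derivative G' j) (at x)"
    using G unfolding differentiable_def by metis
  have first: "partial_deriv j f y = G j y" if "y \<in> U" for j y
  proof -
    have "axis j 1 $ i * G i y = (if i = j then G i y else 0)" for i by (simp add: axis_def)
    then show ?thesis unfolding partial_deriv_eqI[OF f[OF that]] by simp
  qed
  have second: "partial_deriv i (partial_deriv j f) x = G' j (axis i 1)" for i j
    using partial_deriv_cong_open[OF assms(1,2) first] partial_deriv_eqI[OF G'] by simp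
  have expand: "G' j v = (\<Sum>i\<in>UNIV. v $ i * G' j (axis i 1))" for j
  proof -
    have lin: "linear (G' j)" using G' by (rule has_derivative_linear)
    have "G' j v = G' j (\<Sum>i\<in>UNIV. v $ i *\<^sub>R axis i 1)"
      by (simp add: basis_expansion flip: scalar_mult_eq_scaleR)
    then show ?thesis by (simp add: linear_sum[OF lin] linear_cmul[OF lin])
  qed
  have "second_differential f x v = (\<Sum>j\<in>UNIV. v $ j * G' j v)"
    unfolding second_differential_def second expand sum_distrib_left
    by (subst sum.swap) (simp add: mult_ac)
  moreover have "((\<lambda>t. \<Sum>j\<in>UNIV. v $ j * G j (x + t *\<^sub>R v)) has_real_derivative
      (\<Sum>j\<in>UNIV. v $ j * G' j v)) (at 0)"
    by (intro DERIV_sum DERIV_cmult has_real_derivative_along_line) (use G' in simp)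
  ultimately show ?thesis by simp
qed

text \<open>A concave function lies below its tangents, so its derivative is decreasing.\<close>
lemma concave_on_second_derivative_nonpos:
  fixes h h' :: "real \<Rightarrow> real"
  assumes "concave_on T h" and "open T" and "a \<in> T"
    and h: "\<And>t. t \<in> T \<Longrightarrow> (h has_real_derivative h' t) (at t)"
    and h': "(h' has_real_derivative d) (at a)"
  shows "d \<le> 0"
proof -
  have conv: "convex_on T (\<lambda>t. - h t)" using assms(1) by (simp add: concave_on_def)
  have conn: "connected T" using assms(1) concave_on_imp_convex convex_connected by blast
  have tangent: "- h t - - h s \<ge> - h' s * (t - s)" if "s \<in> T" "t \<in> T" for s t
    using that assms(2)
    by (intro convex_on_imp_above_tangent[OF conv conn])
      (auto simp: interior_open intro!: DERIV_minus[OF DERIV_subset[OF h]])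
  have "mono_on T (\<lambda>t. - h' t)"
  proof (rule mono_onI)
    fix s t assume st: "s \<in> T" "t \<in> T" "s \<le> t"
    have "(h' t - h' s) * (t - s) \<le> 0"
      using tangent[of s t] tangent[of t s] st by (simp add: algebra_simps)
    then show "- h' s \<le> - h' t"
      using st by (cases "s = t") (auto simp: mult_le_0_iff)
  qed
  moreover have "((\<lambda>t. - h' t) has_real_derivative - d) (at a)" using h' by (rule DERIV_minus)
  ultimately have "- d \<ge> 0"
    using mono_on_imp_deriv_nonneg assms(2,3) interior_open by metis
  then show ?thesis by simp
qed

section \<open>The bound for the Hessian\<close>

lemma open_positive_cone: "open (positive_cone :: (real ^ 'n) set)"
proof -
  have "positive_cone = (\<Inter>j. {x :: real ^ 'n. 0 < x $ j})" by (auto simp: positive_cone_def)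
  moreover have "open \<dots>" by (intro open_INT ballI open_Collect_less continuous_intros) auto
  ultimately show ?thesis by simp
qed

lemma concave_on_line:
  fixes x v :: "real ^ 'n"
  assumes "concave_on U f"
  shows "concave_on {t. x + t *\<^sub>R v \<in> U} (\<lambda>t. f (x + t *\<^sub>R v))"
proof -
  have comb: "x + (u * s + w * t) *\<^sub>R v = u *\<^sub>R (x + s *\<^sub>R v) + w *\<^sub>R (x + t *\<^sub>R v)"
    if "u + w = 1" for u w s t :: real
  proof -
    have "x = (u + w) *\<^sub>R x" using that by simp
    then show ?thesis by (simp add: algebra_simps)
  qed
  show ?thesis
    using assms unfolding concave_on_iff convex_def by (auto simp: comb)
qed

lemma esym_2_line:
  fixes x v :: "real ^ 'n"
  shows "2 * esym 2 S (x + t *\<^sub>R v) = 2 * esym 2 S x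
    + 2 * t * ((\<Sum>i\<in>S. x $ i) * (\<Sum>i\<in>S. v $ i) - (\<Sum>i\<in>S. x $ i * v $ i))
    + 2 * t\<^sup>2 * esym 2 S v"
proof -
  have "(\<Sum>i\<in>S. (x $ i + t * v $ i)\<^sup>2) = (\<Sum>i\<in>S. (x $ i)\<^sup>2)
      + 2 * t * (\<Sum>i\<in>S. x $ i * v $ i) + t\<^sup>2 * (\<Sum>i\<in>S. (v $ i)\<^sup>2)"
    by (simp add: sum_distrib_left flip: sum.distrib)
      (simp add: power2_eq_square algebra_simps)
  moreover have "(\<Sum>i\<in>S. x $ i + t * v $ i) = (\<Sum>i\<in>S. x $ i) + t * (\<Sum>i\<in>S. v $ i)"
    by (simp add: sum.distrib sum_distrib_left)
  moreover have "2 * t\<^sup>2 * esym 2 S v = t\<^sup>2 * (2 * esym 2 S v)" by simp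
  ultimately show ?thesis
    unfolding esym_2 by (simp add: esym_2 power2_eq_square algebra_simps)
qed

text \<open>
  Along the line, \<open>2 e\<^sub>2\<close> is the quadratic \<open>A + B t + C t\<^sup>2 / 2\<close>, so the right-hand side is
  the second derivative of its logarithm at \<open>0\<close>. The inequality holds because
  \<open>ln e\<^sub>k - ln e\<^sub>2\<close> is concave along the line.
\<close>
lemma second_differential_log_elem_sym_le_esym_2:
  fixes x v :: "real ^ 'n"
  assumes "2 \<le> k" and "k \<le> CARD('n)" and "x \<in> positive_cone"
  defines "A \<equiv> 2 * esym 2 UNIV x"
    and "B \<equiv> 2 * ((\<Sum>i\<in>UNIV. x $ i) * (\<Sum>i\<in>UNIV. v $ i) - (\<Sum>i\<in>UNIV. x $ i * v $ i))"
    and "C \<equiv> 4 * esym 2 UNIV v"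
  shows "second_differential (log_elem_sym k) x v \<le> C / A - (B / A)\<^sup>2"
proof -
  obtain m where m: "k = Suc m" using assms(1) by (cases k) auto
  let ?T = "{t. x + t *\<^sub>R v \<in> positive_cone}"
  define G where "G j y = esym m (UNIV - {j}) y / esym k UNIV y" for j and y :: "real ^ 'n"
  have pos_k: "0 < esym k UNIV y" and pos_2: "0 < esym 2 UNIV y"
    if "y \<in> positive_cone" for y :: "real ^ 'n"
    using that assms(1,2) by (auto intro!: esym_pos)
  have deriv: "(log_elem_sym k has_derivative (\<lambda>h. \<Sum>j\<in>UNIV. h $ j * G j y)) (at y)"
    if "y \<in> positive_cone" for y :: "real ^ 'n"
  proof -
    have "log_elem_sym k = (\<lambda>y :: real ^ 'n. ln (esym (Suc m) UNIV y))"
      by (simp add: fun_eq_iff log_elem_sym_def elem_sym_eq_esym m)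
    then show ?thesis
      using has_derivative_ln[OF _ has_derivative_esym, of m UNIV y] pos_k[OF that]
      by (auto simp: m G_def sum_distrib_right sum_distrib_left divide_inverse mult_ac
          elim!: has_derivative_eq_rhs)
  qed
  have esym_diff: "esym l S differentiable (at y)" for l S and y :: "real ^ 'n"
  proof (cases l)
    case 0
    have "esym 0 S = (\<lambda>y :: real ^ 'n. 1)" by auto
    then show ?thesis using 0 by simp
  next
    case (Suc l')
    then show ?thesis using has_derivative_esym unfolding differentiable_def by blast
  qed
  have G_diff: "G j differentiable (at x)" for j
    unfolding G_def[abs_def] using pos_k[OF assms(3)] by (intro differentiable_divide esym_diff) auto
  have quad: "2 * esym 2 UNIV (x + t *\<^sub>R v) = A + B * t + C / 2 * t\<^sup>2" for t
    unfolding esym_2_line A_def B_def C_def by (simp add: algebra_simps)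
  define h where "h t = ln (esym k UNIV (x + t *\<^sub>R v)) - ln (esym 2 UNIV (x + t *\<^sub>R v))" for t
  define h' where "h' t = (\<Sum>j\<in>UNIV. v $ j * G j (x + t *\<^sub>R v))
      - (B + C * t) / (A + B * t + C / 2 * t\<^sup>2)" for t
  have A: "A \<noteq> 0" using pos_2[OF assms(3)] by (simp add: A_def)
  have "concave_on ?T h"
    unfolding h_def by (rule concave_on_line[OF concave_on_ln_esym_ratio[OF assms(1,2)]])
  moreover have "(h has_real_derivative h' t) (at t)" if "t \<in> ?T" for t
  proof -
    have "((\<lambda>t. ln (esym k UNIV (x + t *\<^sub>R v))) has_real_derivative
        (\<Sum>j\<in>UNIV. v $ j * G j (x + t *\<^sub>R v))) (at t)"
      using has_real_derivative_along_line[OF deriv, of x t v] that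
      by (simp add: log_elem_sym_def elem_sym_eq_esym)
    moreover have "((\<lambda>t. ln ((A + B * t + C / 2 * t\<^sup>2) / 2)) has_real_derivative
        (B + C * t) / (A + B * t + C / 2 * t\<^sup>2)) (at t)"
      using pos_2[of "x + t *\<^sub>R v"] that quad[of t]
      by (auto intro!: derivative_eq_intros simp: power2_eq_square field_simps)
    ultimately have "((\<lambda>t. ln (esym k UNIV (x + t *\<^sub>R v)) - ln ((A + B * t + C / 2 * t\<^sup>2) / 2))
        has_real_derivative h' t) (at t)"
      unfolding h'_def by (rule DERIV_diff)
    then show ?thesis unfolding h_def quad[symmetric] by simp
  qed
  moreover have "(h' has_real_derivative
      second_differential (log_elem_sym k) x v - (C / A - (B / A)\<^sup>2)) (at 0)"
    unfolding h'_def
  proof (rule DERIV_diff)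
    show "((\<lambda>t. \<Sum>j\<in>UNIV. v $ j * G j (x + t *\<^sub>R v)) has_real_derivative
        second_differential (log_elem_sym k) x v) (at 0)"
      by (rule second_differential_along_line[OF open_positive_cone assms(3) deriv G_diff])
    show "((\<lambda>t. (B + C * t) / (A + B * t + C / 2 * t\<^sup>2)) has_real_derivative
        C / A - (B / A)\<^sup>2) (at 0)"
      using A by (auto intro!: derivative_eq_intros simp: power2_eq_square field_simps)
  qed
  ultimately have "second_differential (log_elem_sym k) x v - (C / A - (B / A)\<^sup>2) \<le> 0"
    using assms(3) by (intro concave_on_second_derivative_nonpos[of ?T h 0 h'] open_line_preimage
        open_positive_cone) auto
  then show ?thesis by simp
qed

text \<open>
  Here \<open>m x\<close> is the radial part of \<open>v\<close>: the remainder \<open>v - m x\<close> has coordinate sum zero.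
  Expressing \<open>B\<close> and \<open>C\<close> of the preceding bound through \<open>m\<close> and this remainder leaves
  \<open>- m\<^sup>2\<close>, a negative square, and \<open>- 2 / A\<close> times the squared length of the
  remainder, where \<open>A \<le> s\<^sup>2\<close>.
\<close>
lemma second_differential_log_elem_sym_le:
  fixes x v :: "real ^ 'n"
  assumes "2 \<le> k" and "k \<le> CARD('n)" and "x \<in> positive_cone"
  defines "s \<equiv> \<Sum>i\<in>UNIV. x $ i" and "m \<equiv> (\<Sum>i\<in>UNIV. v $ i) / (\<Sum>i\<in>UNIV. x $ i)"
  shows "second_differential (log_elem_sym k) x v
    \<le> - m\<^sup>2 - 2 * (\<Sum>i\<in>UNIV. (v $ i - m * x $ i)\<^sup>2) / s\<^sup>2"
proof -
  define Z where "Z = (\<Sum>i\<in>UNIV. (v $ i - m * x $ i)\<^sup>2)"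
  define p where "p = (\<Sum>i\<in>UNIV. x $ i * v $ i)"
  define r where "r = (\<Sum>i\<in>UNIV. (x $ i)\<^sup>2)"
  define A where "A = 2 * esym 2 UNIV x"
  \<comment> \<open>The coordinate sum is \<open>esym 1\<close>, so its positivity is a case of \<open>esym_pos\<close>.\<close>
  have "0 < esym (Suc 0) UNIV x" using assms by (intro esym_pos) auto
  then have s: "0 < s" by (simp add: esym_1 s_def)
  then have sv: "(\<Sum>i\<in>UNIV. v $ i) = m * s" by (simp add: m_def s_def)
  have "A > 0" unfolding A_def using assms by (simp add: esym_pos)
  have r: "r = s\<^sup>2 - A" by (simp add: A_def r_def s_def esym_2)
  have "0 \<le> r" unfolding r_def by (intro sum_nonneg) auto
  then have "A \<le> s\<^sup>2" using r by simp
  have "0 \<le> Z" unfolding Z_def by (intro sum_nonneg) auto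
  have Z: "(\<Sum>i\<in>UNIV. (v $ i)\<^sup>2) = Z + 2 * m * p - m\<^sup>2 * r"
    unfolding Z_def p_def r_def
    by (simp add: sum_distrib_left flip: sum.distrib sum_subtractf)
      (simp add: power2_eq_square algebra_simps)
  have C: "4 * esym 2 UNIV v = 2 * ((m * s)\<^sup>2 - (Z + 2 * m * p - m\<^sup>2 * r))"
    using esym_2[of UNIV v] unfolding sv Z by simp
  have "second_differential (log_elem_sym k) x v
      \<le> 2 * ((m * s)\<^sup>2 - (Z + 2 * m * p - m\<^sup>2 * r)) / A - (2 * (s * (m * s) - p) / A)\<^sup>2"
    using second_differential_log_elem_sym_le_esym_2[OF assms(1-3), of v]
    unfolding C sv A_def[symmetric] s_def[symmetric] p_def[symmetric] .
  \<comment> \<open>\<open>p - m r\<close> is the inner product of \<open>x\<close> with the remainder \<open>v - m x\<close>.\<close>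
  also have "\<dots> = - m\<^sup>2 - (m - 2 * (p - m * r) / A)\<^sup>2 - 2 * Z / A"
    using \<open>A > 0\<close> unfolding r by (simp add: power2_eq_square field_simps)
  also have "\<dots> \<le> - m\<^sup>2 - 2 * Z / A" by simp
  also have "\<dots> \<le> - m\<^sup>2 - 2 * Z / s\<^sup>2"
    using \<open>A > 0\<close> \<open>A \<le> s\<^sup>2\<close> \<open>0 \<le> Z\<close> s by (intro diff_left_mono divide_left_mono) auto
  finally show ?thesis by (simp add: Z_def)
qed

lemma pinched_cone_coordinate_ge:
  fixes x :: "real ^ 'n"
  assumes "x \<in> pinched_cone \<gamma>" and "0 < \<gamma>"
  shows "\<gamma> * (\<Sum>j\<in>UNIV. x $ j) \<le> real CARD('n) * x $ i"
proof -
  let ?M = "Max (range (\<lambda>j. x $ j))"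
  have "\<gamma> * ?M \<le> Min (range (\<lambda>j. x $ j))" using assms(1) by (simp add: pinched_cone_def)
  also have "\<dots> \<le> x $ i" by simp
  finally have "\<gamma> * ?M \<le> x $ i" .
  moreover have "(\<Sum>j\<in>UNIV. x $ j) \<le> real CARD('n) * ?M"
    using sum_bounded_above[of UNIV "\<lambda>j. x $ j" ?M] by simp
  then have "\<gamma> * (\<Sum>j\<in>UNIV. x $ j) \<le> real CARD('n) * (\<gamma> * ?M)"
    using mult_left_mono[of "\<Sum>j\<in>UNIV. x $ j" "real CARD('n) * ?M" \<gamma>] assms(2)
    by (simp add: algebra_simps)
  ultimately show ?thesis
    by (smt (verit) mult_left_mono of_nat_0_le_iff)
qed

text \<open>This recombines the transversal part of the Hessian bound, a sum over \<open>w\<^sub>i - m\<close>, and the radial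
  part \<open>m\<close>.\<close>
lemma norm_power2_le_deviation:
  fixes w :: "real ^ 'n"
  shows "(norm w)\<^sup>2 \<le> 2 * (\<Sum>i\<in>UNIV. (w $ i - m)\<^sup>2) + 2 * real CARD('n) * m\<^sup>2"
proof -
  have "(norm w)\<^sup>2 = (\<Sum>i\<in>UNIV. (w $ i)\<^sup>2)"
    by (simp add: norm_vec_def L2_set_def sum_nonneg)
  also have "\<dots> \<le> (\<Sum>i\<in>UNIV. 2 * (w $ i - m)\<^sup>2 + 2 * m\<^sup>2)"
  proof (rule sum_mono)
    fix i
    have "0 \<le> (w $ i - 2 * m)\<^sup>2" by simp
    then show "(w $ i)\<^sup>2 \<le> 2 * (w $ i - m)\<^sup>2 + 2 * m\<^sup>2"
      by (simp add: power2_eq_square algebra_simps)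
  qed
  also have "\<dots> = 2 * (\<Sum>i\<in>UNIV. (w $ i - m)\<^sup>2) + 2 * real CARD('n) * m\<^sup>2"
    by (simp add: sum.distrib sum_distrib_left)
  finally show ?thesis .
qed

lemma scaled_second_differential_log_elem_sym_le:
  fixes x w :: "real ^ 'n"
  assumes "2 \<le> k" and "k \<le> CARD('n)" and "0 < \<gamma>" and "x \<in> pinched_cone \<gamma>"
  shows "scaled_second_differential (log_elem_sym k) x w
    \<le> - min ((\<gamma> / real CARD('n))\<^sup>2) (1 / (2 * real CARD('n))) * (norm w)\<^sup>2"
proof -
  let ?n = "real CARD('n)"
  \<comment> \<open>The factors of \<open>D\<close> and \<open>m\<^sup>2\<close> in \<open>norm_power2_le_deviation\<close> are \<open>2\<close> and \<open>2 n\<close>; the minimum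
    makes \<open>c\<close> small enough for both parts of the Hessian bound.\<close>
  let ?c = "min ((\<gamma> / ?n)\<^sup>2) (1 / (2 * ?n))"
  define v where "v = (\<chi> i. x $ i * w $ i)"
  define s where "s = (\<Sum>i\<in>UNIV. x $ i)"
  define m where "m = (\<Sum>i\<in>UNIV. v $ i) / s"
  define D where "D = (\<Sum>i\<in>UNIV. (w $ i - m)\<^sup>2)"
  have x: "x \<in> positive_cone" using assms(4) by (simp add: pinched_cone_def)
  have n: "0 < ?n" by simp
  have "0 < esym (Suc 0) UNIV x" using assms x by (intro esym_pos) auto
  then have s: "0 < s" by (simp add: esym_1 s_def)
  have "(\<gamma> / ?n)\<^sup>2 * s\<^sup>2 * D \<le> (\<Sum>i\<in>UNIV. (v $ i - m * x $ i)\<^sup>2)"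
    unfolding D_def sum_distrib_left
  proof (rule sum_mono)
    fix i
    have "\<gamma> / ?n * s \<le> x $ i"
      using pinched_cone_coordinate_ge[OF assms(4,3), of i] n by (simp add: s_def field_simps)
    then have "(\<gamma> / ?n * s)\<^sup>2 \<le> (x $ i)\<^sup>2" using assms(3) s by (intro power_mono) auto
    then have "(\<gamma> / ?n * s)\<^sup>2 * (w $ i - m)\<^sup>2 \<le> (x $ i)\<^sup>2 * (w $ i - m)\<^sup>2"
      by (rule mult_right_mono) simp
    also have "\<dots> = (v $ i - m * x $ i)\<^sup>2" by (simp add: v_def power2_eq_square algebra_simps)
    finally show "(\<gamma> / ?n)\<^sup>2 * s\<^sup>2 * (w $ i - m)\<^sup>2 \<le> (v $ i - m * x $ i)\<^sup>2"
      by (simp only: power_mult_distrib)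
  qed
  then have dev: "(\<gamma> / ?n)\<^sup>2 * D \<le> (\<Sum>i\<in>UNIV. (v $ i - m * x $ i)\<^sup>2) / s\<^sup>2"
    using s by (simp add: pos_le_divide_eq mult_ac)
  have "0 \<le> D" unfolding D_def by (intro sum_nonneg) auto
  have c: "0 \<le> ?c" "?c \<le> (\<gamma> / ?n)\<^sup>2" "?c \<le> 1 / (2 * ?n)" by auto
  have "?c * (norm w)\<^sup>2 \<le> ?c * (2 * D + 2 * ?n * m\<^sup>2)"
    unfolding D_def by (rule mult_left_mono[OF norm_power2_le_deviation c(1)])
  also have "\<dots> = 2 * (?c * D) + ?c * (2 * ?n) * m\<^sup>2" by (simp only: algebra_simps)
  also have "\<dots> \<le> 2 * ((\<gamma> / ?n)\<^sup>2 * D) + 1 * m\<^sup>2"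
  proof (intro add_mono mult_left_mono mult_right_mono)
    show "?c * (2 * ?n) \<le> 1" using c(3) n by (simp only: pos_le_divide_eq)
  qed (use c \<open>0 \<le> D\<close> in auto)
  finally have "?c * (norm w)\<^sup>2 \<le> m\<^sup>2 + 2 * (\<Sum>i\<in>UNIV. (v $ i - m * x $ i)\<^sup>2) / s\<^sup>2"
    using dev by simp
  moreover have "scaled_second_differential (log_elem_sym k) x w
      \<le> - m\<^sup>2 - 2 * (\<Sum>i\<in>UNIV. (v $ i - m * x $ i)\<^sup>2) / s\<^sup>2"
    using second_differential_log_elem_sym_le[OF assms(1,2) x, of v]
    unfolding scaled_second_differential_def v_def[symmetric] s_def[symmetric] m_def[symmetric] .
  ultimately show ?thesis by linarith
qed

lemma admissible_ratio_pos:
  assumes "admissible_ratio n k \<gamma>"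
  shows "0 < \<gamma>"
proof -
  have "n div 2 + 1 \<le> k \<Longrightarrow> k + 3 \<le> n \<Longrightarrow> 0 < (real n - real k) / real k"
    by (intro divide_pos_pos) auto
  moreover have "5 \<le> k \<Longrightarrow> k \<le> n div 2 \<Longrightarrow> 0 < (real k - 2) / (real n - (real k - 2))"
    by (intro divide_pos_pos) auto
  ultimately show ?thesis using assms unfolding admissible_ratio_def by auto
qed

theorem theorem4p12:
  fixes k :: nat and \<gamma> :: real
  assumes "2 \<le> k" and "k \<le> CARD('n::finite) - 1"
    and "admissible_ratio CARD('n) k \<gamma>"
  shows "\<exists>c>0. \<forall>x \<in> (pinched_cone \<gamma> :: (real ^ 'n) set). \<forall>w :: real ^ 'n.
    scaled_second_differential (log_elem_sym k) x w \<le> - c * (norm w)\<^sup>2"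
proof -
  let ?c = "min ((\<gamma> / real CARD('n))\<^sup>2) (1 / (2 * real CARD('n)))"
  have \<gamma>: "0 < \<gamma>" using assms(3) by (rule admissible_ratio_pos)
  have "k \<le> CARD('n)" using assms(2) by simp
  note bound = scaled_second_differential_log_elem_sym_le[OF assms(1) this \<gamma>]
  have "0 < ?c" using \<gamma> by simp
  with bound show ?thesis by blast
qed

end
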